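(* Each regular operator $T$ from a vector lattice $X$ to a locally solid lattice $(Y,\tau)$ is $o\tau$-bounded.
   Context: All vector spaces are real, operators are linear, vector topologies are Hausdorff, vector lattices are Archimedean. A locally solid lattice is a vector lattice with a linear topology having a base at zero of solid sets. An operator between vector lattices is regular if it is a difference of two positive operators. An operator $T$ from a vector lattice $X$ to a topological vector space $(Y,\tau)$ is $o\tau$-bounded if $T[0,x]$ is a $\tau$-bounded subset of $Y$ for each $x\in X_+$. *)

theory Defs
  imports "HOL-Analysis.Analysis" "HOL-Library.Lattice_Algebras"
begin

text \<open>
  The class \<^class>\<open>lattice_ab_group_add_abs\<close> supplies the lattice operations and
  the modulus \<open>\<bar>x\<bar> = sup x (- x)\<close>.
\<close>

class vector_lattice = ordered_real_vector + lattice_ab_group_add_abs +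
  assumes archimedean: "(\<And>n::nat. n \<ge> 1 \<Longrightarrow> real n *\<^sub>R x \<le> y) \<Longrightarrow> x \<le> 0"

text \<open>
  Joint continuity is expressed as in the library's \<^class>\<open>topological_ab_group_add\<close>.
\<close>

class hausdorff_tvs = real_vector + topological_ab_group_add + t2_space +
  assumes tendsto_scaleR_Pair:
    "LIM p (nhds c \<times>\<^sub>F nhds a). fst p *\<^sub>R snd p :> nhds (c *\<^sub>R a)"

definition (in vector_lattice) solid :: "'a set \<Rightarrow> bool" where
  "solid S \<longleftrightarrow> (\<forall>x y. y \<in> S \<and> \<bar>x\<bar> \<le> \<bar>y\<bar> \<longrightarrow> x \<in> S)"

text \<open>The solid sets in the base are neighbourhoods of zero, not necessarily open.\<close>

class locally_solid_lattice = vector_lattice + hausdorff_tvs +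
  assumes solid_base_at_zero:
    "open U \<Longrightarrow> 0 \<in> U \<Longrightarrow>
      \<exists>V. solid V \<and> V \<subseteq> U \<and> eventually (\<lambda>x. x \<in> V) (nhds 0)"

definition positive_operator :: "('a::vector_lattice \<Rightarrow> 'b::vector_lattice) \<Rightarrow> bool" where
  "positive_operator T \<longleftrightarrow> linear T \<and> (\<forall>x\<ge>0. T x \<ge> 0)"

definition regular_operator :: "('a::vector_lattice \<Rightarrow> 'b::vector_lattice) \<Rightarrow> bool" where
  "regular_operator T \<longleftrightarrow>
    (\<exists>P Q. positive_operator P \<and> positive_operator Q \<and> T = (\<lambda>x. P x - Q x))"

text \<open>
  Boundedness with respect to the linear topology (absorption by every neighbourhood of
  zero); the library's \<^const>\<open>bounded\<close> is the metric notion. It suffices to test open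
  neighbourhoods.
\<close>

definition tvs_bounded :: "'a::hausdorff_tvs set \<Rightarrow> bool" where
  "tvs_bounded B \<longleftrightarrow>
    (\<forall>U. open U \<and> 0 \<in> U \<longrightarrow> (\<exists>r>0. B \<subseteq> (\<lambda>u. r *\<^sub>R u) ` U))"

definition order_topology_bounded :: "('a::vector_lattice \<Rightarrow> 'b::hausdorff_tvs) \<Rightarrow> bool" where
  "order_topology_bounded T \<longleftrightarrow> linear T \<and> (\<forall>x\<ge>0. tvs_bounded (T ` {0..x}))"

end

theory Submission
  imports Defs
begin

text \<open>
  Write \<open>T = P - Q\<close> with positive \<open>P\<close> and \<open>Q\<close>. Positive operators are monotone, so on an order
  interval \<open>{0..x}\<close> the values of \<open>P\<close> lie in \<open>{0..P x}\<close> and those of \<open>Q\<close> in \<open>{0..Q x}\<close>. The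
  differences therefore lie in the symmetric order interval \<open>{-y..y}\<close> with \<open>y = P x + Q x\<close>.
  What remains concerns the range space alone: order intervals of a locally solid lattice are
  topologically bounded (\<open>tvs_bounded_symmetric_interval\<close>). Indeed, by continuity of scalar
  multiplication a small positive multiple of \<open>y\<close> enters any given solid neighbourhood of zero,
  and solidity then puts the same multiple of all of \<open>{-y..y}\<close> into that neighbourhood.
\<close>

lemma tendsto_scaleR_at_right_0:
  fixes y :: "'a::hausdorff_tvs"
  shows "((\<lambda>c. c *\<^sub>R y) \<longlongrightarrow> 0) (at_right 0)"
proof -
  have "LIM c at_right 0. (c, y) :> nhds (0::real) \<times>\<^sub>F nhds y"
    by (intro filterlim_Pair tendsto_const tendsto_ident_at)
  from filterlim_compose[OF tendsto_scaleR_Pair this] show ?thesis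
    by simp
qed

lemma tvs_bounded_subset:
  assumes "tvs_bounded B" "A \<subseteq> B"
  shows "tvs_bounded A"
  using assms unfolding tvs_bounded_def by (meson subset_trans)

text \<open>
  This is where the compatibility of order and topology enters: solidity turns absorption of the
  single point \<open>y\<close> into absorption of every element that \<open>y\<close> dominates in modulus.
\<close>

lemma tvs_bounded_symmetric_interval:
  fixes y :: "'a::locally_solid_lattice"
  shows "tvs_bounded {-y..y}"
  unfolding tvs_bounded_def
proof (intro allI impI, elim conjE)
  fix U :: "'a set"
  assume "open U" "0 \<in> U"
  then obtain V where V: "solid V" "V \<subseteq> U" "eventually (\<lambda>x. x \<in> V) (nhds 0)"
    using solid_base_at_zero by blast
  have "eventually (\<lambda>c. c *\<^sub>R y \<in> V) (at_right 0)"
    using V(3) tendsto_scaleR_at_right_0 by (rule eventually_compose_filterlim)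
  moreover have "eventually (\<lambda>c::real. c > 0) (at_right 0)"
    by (rule eventually_at_right_less)
  ultimately have "eventually (\<lambda>c. c > 0 \<and> c *\<^sub>R y \<in> V) (at_right 0)"
    by eventually_elim simp
  then obtain c where c: "c > 0" "c *\<^sub>R y \<in> V"
    using eventually_happens'[OF trivial_limit_at_right_real] by blast
  have "z \<in> (\<lambda>u. inverse c *\<^sub>R u) ` U" if z: "z \<in> {-y..y}" for z
  proof -
    have "- z \<le> y"
      using z by (simp add: minus_le_iff)
    then have "c *\<^sub>R z \<le> c *\<^sub>R y" "- (c *\<^sub>R z) \<le> c *\<^sub>R y"
      using z c(1) scaleR_left_mono[of "- z" y c] by (auto intro: scaleR_left_mono)
    then have "\<bar>c *\<^sub>R z\<bar> \<le> \<bar>c *\<^sub>R y\<bar>"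
      by (meson abs_leI abs_ge_self order_trans)
    then have "c *\<^sub>R z \<in> U"
      using V c(2) unfolding solid_def by blast
    moreover have "z = inverse c *\<^sub>R (c *\<^sub>R z)"
      using c(1) by simp
    ultimately show ?thesis
      by blast
  qed
  then show "\<exists>r>0. {-y..y} \<subseteq> (\<lambda>u. r *\<^sub>R u) ` U"
    using c(1) by (intro exI[of _ "inverse c"]) auto
qed

lemma positive_operator_mono:
  assumes "positive_operator P" "u \<le> x"
  shows "P u \<le> P x"
proof -
  have "0 \<le> P (x - u)"
    using assms unfolding positive_operator_def by simp
  also have "P (x - u) = P x - P u"
    using assms(1) unfolding positive_operator_def by (simp add: linear_diff)
  finally show ?thesis
    by simp
qed

theorem proposition2p1:
  fixes T :: "'a::vector_lattice \<Rightarrow> 'b::locally_solid_lattice"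
  assumes "regular_operator T"
  shows "order_topology_bounded T"
proof -
  obtain P Q where P: "positive_operator P" and Q: "positive_operator Q"
    and T: "T = (\<lambda>x. P x - Q x)"
    using assms unfolding regular_operator_def by blast
  have "linear T"
    using P Q unfolding T positive_operator_def by (blast intro: linear_compose_sub)
  moreover have "tvs_bounded (T ` {0..x})" for x
  proof (rule tvs_bounded_subset[OF tvs_bounded_symmetric_interval])
    show "T ` {0..x} \<subseteq> {- (P x + Q x)..P x + Q x}"
    proof (rule image_subsetI)
      fix u assume u: "u \<in> {0..x}"
      have "0 \<le> P u" "0 \<le> Q u"
        using P Q u unfolding positive_operator_def by auto
      moreover have "P u \<le> P x" "Q u \<le> Q x"
        using P Q u by (auto intro: positive_operator_mono)
      ultimately have "0 \<le> P x" "0 \<le> Q x"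
        by (blast intro: order_trans)+
      then have "P u - Q u \<le> P x + Q x" "Q u - P u \<le> P x + Q x"
        using \<open>0 \<le> P u\<close> \<open>0 \<le> Q u\<close> \<open>P u \<le> P x\<close> \<open>Q u \<le> Q x\<close>
        by (simp_all add: diff_le_eq add_increasing add_increasing2)
      then show "T u \<in> {- (P x + Q x)..P x + Q x}"
        unfolding T using minus_le_iff[of "P x + Q x" "P u - Q u"] by simp
    qed
  qed
  ultimately show ?thesis
    unfolding order_topology_bounded_def by blast
qed

end
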